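(* Let $m\ge 1$ be an integer, let $(A,\kappa_1)$ be a digitally connected digital image, let $(A',\lambda_1)$ be any digital image, and let $h,k:(A,\kappa_1)\to(A',\lambda_1)$ be digitally continuous maps. Then $$\mathrm{D}_m(h,k)\le\mathrm{cat}_m(A,\kappa_1)\le\mathrm{TC}^m(A,\kappa_1)\le\mathrm{cat}_m(A\times A,\mathrm{NP}(\kappa_1,\kappa_1)).$$
   Context: Digital images: a digital image is a pair $(A,\kappa)$ with $A\subseteq\mathbb{Z}^r$ and $\kappa$ an adjacency relation on $A$; the basic ones are $c_p$ ($1\le p\le r$), where distinct $a,a'\in\mathbb{Z}^r$ are $c_p$-adjacent iff there are at most $p$ indices $i$ with $|a_i-a'_i|=1$ and $a_i=a'_i$ for all other $i$. Subsets carry the restricted adjacency. $a\leftrightarrow_\kappa a'$ means adjacent. A map $h:(A,\kappa)\to(A',\lambda)$ is digitally $(\kappa,\lambda)$-continuous if $a\leftrightarrow_\kappa a'$ implies that $h(a)=h(a')$ or $h(a)\leftrightarrow_\lambda h(a')$. On a product of digital images, the adjacency $\mathrm{NP}$ (normal/strong product) declares two distinct points adjacent iff in each coordinate they are equal or adjacent. $(A,\kappa)$ is digitally connected ($\kappa$-connected) if any two points are joined by a finite sequence $b_0,\dots,b_l$ in $A$ with $b_i=b_{i+1}$ or $b_i\leftrightarrow_\kappa b_{i+1}$ for each $i$. Homotopy: $[0,z]_{\mathbb{Z}}=\{0,1,\dots,z\}$ carries the adjacency $2=c_1$ of $\mathbb{Z}$. Digitally continuous $h,k:(A,\kappa)\to(A',\lambda)$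 are digitally homotopic, $h\simeq_{\kappa,\lambda}k$, if for some $z$ there is a digitally continuous $K:(A\times[0,z]_{\mathbb{Z}},\mathrm{NP}(\kappa,2))\to(A',\lambda)$ with $K(a,0)=h(a)$, $K(a,z)=k(a)$ for all $a$. A map is digitally nullhomotopic if it is digitally homotopic to a constant map. Path space: $A^{[0,z]_{\mathbb{Z}}}$ is the set of digitally continuous maps $[0,z]_{\mathbb{Z}}\to A$, where $\vartheta,\theta$ are adjacent iff, whenever $t=t'$ or $t\leftrightarrow_2t'$, the points $\vartheta(t)$ and $\theta(t')$ are equal or adjacent in $A$. For $m>0$, an $m$-dimensional digital complex is a finite digital image $(P,\delta)$ with $P\subseteq\mathbb{Z}^m$. Each of the following is the least integer $q\ge0$ with the stated property ($\infty$ if none). $\mathrm{D}_m(h,k)$ (digital $m$-homotopic distance): $A=X_0\cup\dots\cup X_q$ where, for each $j$, every $m$-dimensional digital complex $(P,\delta)$ and every $(\delta,\kappa_1)$-continuous $\phi:P\to X_j$ satisfy $h\circ\phi\simeq_{\delta,\lambda_1}k\circ\phi$. $\mathrm{cat}_m(A,\kappa_1)$ (digital $m$-Lusternik-Schnirelmann category): $A=X_0\cup\dots\cup X_q$ such that for each $j$, every $m$-dimensional digital complex $(P,\delta)$ and every $(\delta,\kappa_1)$-continuous $\phi:P\to X_j$, the map $i_j\circ\phi:P\to A$ is digitally nullhomotopic, $i_j:X_j\to A$ being the inclusion. $\mathrm{TC}^m(A,\kappa_1)$ (digital $m$-topological complexity), for $A$ digitally connected: $A\times A=X_0\cup\dots\cup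 X_q$ such that for each $j$ there is a digitally continuous $s_j:X_j\to A^{[0,z]_{\mathbb{Z}}}$ (some $z$) such that $\pi\circ s_j\circ\phi$ is digitally homotopic to $\phi$ (as maps into $A\times A$ with $\mathrm{NP}(\kappa_1,\kappa_1)$) for every $m$-dimensional digital complex $P$ and every digitally continuous $\phi:P\to X_j$, where $\pi(\vartheta)=(\vartheta(0),\vartheta(z))$.
   Formalization: Added: h(a) and k(a) are joined by a digital path in A' for every a in A. Without it D_m(h,k) ≤ cat_m(A) fails: A={0}, A'={0,2} with c_1, h=0, k=2 gives D_m=∞ but cat_m(A)=0. *)

theory Defs
  imports Main "HOL-Library.Extended_Nat" "HOL-Library.FuncSet"
begin

text \<open>
  Points of \<open>\<int>\<^sup>r\<close> are integer lists of length \<open>r\<close>, so that the dimension of a digital complex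
  can be a natural number. Notions that depend only on the carrier and its adjacency relation are
  polymorphic in the type of points; this lets them be used for the product \<open>A \<times> A\<close>, a subset of
  \<open>\<int>\<^sup>r \<times> \<int>\<^sup>r\<close>, and for path spaces. Adjacency relations are only ever evaluated on points of the
  carrier, so a subset carries the restricted adjacency automatically.
\<close>

definition int_space :: "nat \<Rightarrow> int list set" where
  "int_space r = {x. length x = r}"

definition adjacency_on :: "'a set \<Rightarrow> ('a \<Rightarrow> 'a \<Rightarrow> bool) \<Rightarrow> bool" where
  "adjacency_on A \<kappa> \<longleftrightarrow>
     (\<forall>a\<in>A. \<not> \<kappa> a a) \<and> (\<forall>a\<in>A. \<forall>a'\<in>A. \<kappa> a a' \<longrightarrow> \<kappa> a' a)"

definition digital_image :: "nat \<Rightarrow> int list set \<Rightarrow> (int list \<Rightarrow> int list \<Rightarrow> bool) \<Rightarrow> bool" where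
  "digital_image r A \<kappa> \<longleftrightarrow> A \<subseteq> int_space r \<and> adjacency_on A \<kappa>"

definition digital_complex :: "nat \<Rightarrow> int list set \<Rightarrow> (int list \<Rightarrow> int list \<Rightarrow> bool) \<Rightarrow> bool" where
  "digital_complex m P \<delta> \<longleftrightarrow> finite P \<and> digital_image m P \<delta>"

definition NP :: "('a \<Rightarrow> 'a \<Rightarrow> bool) \<Rightarrow> ('b \<Rightarrow> 'b \<Rightarrow> bool) \<Rightarrow> 'a \<times> 'b \<Rightarrow> 'a \<times> 'b \<Rightarrow> bool" where
  "NP \<kappa> \<mu> x y \<longleftrightarrow>
     x \<noteq> y \<and> (fst x = fst y \<or> \<kappa> (fst x) (fst y)) \<and> (snd x = snd y \<or> \<mu> (snd x) (snd y))"

text \<open>The adjacency \<open>c\<^sub>1\<close> (that is, 2-adjacency) of \<open>\<int>\<close>, used on the intervals \<open>{0..z}\<close>.\<close>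

definition c1 :: "int \<Rightarrow> int \<Rightarrow> bool" where
  "c1 s t \<longleftrightarrow> \<bar>s - t\<bar> = 1"

definition dig_continuous ::
  "'a set \<Rightarrow> ('a \<Rightarrow> 'a \<Rightarrow> bool) \<Rightarrow> 'b set \<Rightarrow> ('b \<Rightarrow> 'b \<Rightarrow> bool) \<Rightarrow> ('a \<Rightarrow> 'b) \<Rightarrow> bool" where
  "dig_continuous A \<kappa> B \<mu> h \<longleftrightarrow>
     h \<in> A \<rightarrow> B \<and> (\<forall>a\<in>A. \<forall>a'\<in>A. \<kappa> a a' \<longrightarrow> h a = h a' \<or> \<mu> (h a) (h a'))"

text \<open>
  Two maps into a disconnected image need not be joined pointwise, and then their homotopic distance
  can be infinite although the category of the domain is finite: let \<open>h\<close> and \<open>k\<close> be the constants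
  \<open>0\<close> and \<open>2\<close> from \<open>{0}\<close> to \<open>{0, 2}\<close> with \<open>c\<^sub>1\<close>-adjacency. Comparing the two therefore needs
  \<open>h a\<close> and \<open>k a\<close> to be joined in the sense below.
\<close>

definition dig_joined :: "'a set \<Rightarrow> ('a \<Rightarrow> 'a \<Rightarrow> bool) \<Rightarrow> 'a \<Rightarrow> 'a \<Rightarrow> bool" where
  "dig_joined A \<kappa> a a' \<longleftrightarrow>
     (\<exists>(l::nat) b. b 0 = a \<and> b l = a' \<and> (\<forall>i\<le>l. b i \<in> A) \<and>
        (\<forall>i<l. b i = b (Suc i) \<or> \<kappa> (b i) (b (Suc i))))"

definition dig_connected :: "'a set \<Rightarrow> ('a \<Rightarrow> 'a \<Rightarrow> bool) \<Rightarrow> bool" where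
  "dig_connected A \<kappa> \<longleftrightarrow> (\<forall>a\<in>A. \<forall>a'\<in>A. dig_joined A \<kappa> a a')"

definition dig_homotopic ::
  "'a set \<Rightarrow> ('a \<Rightarrow> 'a \<Rightarrow> bool) \<Rightarrow> 'b set \<Rightarrow> ('b \<Rightarrow> 'b \<Rightarrow> bool) \<Rightarrow> ('a \<Rightarrow> 'b) \<Rightarrow> ('a \<Rightarrow> 'b) \<Rightarrow> bool"
  where
  "dig_homotopic A \<kappa> B \<mu> h k \<longleftrightarrow>
     dig_continuous A \<kappa> B \<mu> h \<and> dig_continuous A \<kappa> B \<mu> k \<and>
     (\<exists>z\<ge>0. \<exists>K. dig_continuous (A \<times> {0..z}) (NP \<kappa> c1) B \<mu> K \<and>
        (\<forall>a\<in>A. K (a, 0) = h a \<and> K (a, z) = k a))"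

text \<open>
  The value \<open>c\<close> lies in \<open>B\<close> whenever \<open>A\<close> is nonempty; the map from the empty set counts as constant
  even if \<open>B\<close> is empty.
\<close>

definition dig_nullhomotopic ::
  "'a set \<Rightarrow> ('a \<Rightarrow> 'a \<Rightarrow> bool) \<Rightarrow> 'b set \<Rightarrow> ('b \<Rightarrow> 'b \<Rightarrow> bool) \<Rightarrow> ('a \<Rightarrow> 'b) \<Rightarrow> bool" where
  "dig_nullhomotopic A \<kappa> B \<mu> h \<longleftrightarrow> (\<exists>c. dig_homotopic A \<kappa> B \<mu> h (\<lambda>_. c))"

text \<open>Paths are made extensional so that each map on \<open>{0..z}\<close> is represented exactly once.\<close>

definition path_space :: "'a set \<Rightarrow> ('a \<Rightarrow> 'a \<Rightarrow> bool) \<Rightarrow> int \<Rightarrow> (int \<Rightarrow> 'a) set" where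
  "path_space A \<kappa> z = {\<theta> \<in> extensional {0..z}. dig_continuous {0..z} c1 A \<kappa> \<theta>}"

definition path_adj :: "('a \<Rightarrow> 'a \<Rightarrow> bool) \<Rightarrow> int \<Rightarrow> (int \<Rightarrow> 'a) \<Rightarrow> (int \<Rightarrow> 'a) \<Rightarrow> bool" where
  "path_adj \<kappa> z \<theta> \<eta> \<longleftrightarrow>
     (\<forall>t\<in>{0..z}. \<forall>t'\<in>{0..z}. t = t' \<or> c1 t t' \<longrightarrow> \<theta> t = \<eta> t' \<or> \<kappa> (\<theta> t) (\<eta> t'))"

definition path_ends :: "int \<Rightarrow> (int \<Rightarrow> 'a) \<Rightarrow> 'a \<times> 'a" where
  "path_ends z \<theta> = (\<theta> 0, \<theta> z)"

text \<open>
  The least \<open>q\<close> such that \<open>A = X 0 \<union> \<dots> \<union> X q\<close> with \<open>Q (X j)\<close> for all \<open>j\<close>; it is \<open>\<infinity>\<close> (the infimum of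
  the empty set in \<^typ>\<open>enat\<close>) if there is none.
\<close>

definition cover_number :: "'a set \<Rightarrow> ('a set \<Rightarrow> bool) \<Rightarrow> enat" where
  "cover_number A Q =
     Inf {enat q | q. \<exists>X :: nat \<Rightarrow> 'a set. A = (\<Union>j\<le>q. X j) \<and> (\<forall>j\<le>q. Q (X j))}"

definition dig_dist ::
  "nat \<Rightarrow> 'a set \<Rightarrow> ('a \<Rightarrow> 'a \<Rightarrow> bool) \<Rightarrow> 'b set \<Rightarrow> ('b \<Rightarrow> 'b \<Rightarrow> bool) \<Rightarrow> ('a \<Rightarrow> 'b) \<Rightarrow> ('a \<Rightarrow> 'b) \<Rightarrow> enat"
  where
  "dig_dist m A \<kappa> B \<mu> h k = cover_number A (\<lambda>X.
     \<forall>P \<delta> \<phi>. digital_complex m P \<delta> \<and> dig_continuous P \<delta> X \<kappa> \<phi> \<longrightarrow>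
       dig_homotopic P \<delta> B \<mu> (h \<circ> \<phi>) (k \<circ> \<phi>))"

definition dig_cat :: "nat \<Rightarrow> 'a set \<Rightarrow> ('a \<Rightarrow> 'a \<Rightarrow> bool) \<Rightarrow> enat" where
  "dig_cat m A \<kappa> = cover_number A (\<lambda>X.
     \<forall>P \<delta> \<phi>. digital_complex m P \<delta> \<and> dig_continuous P \<delta> X \<kappa> \<phi> \<longrightarrow>
       dig_nullhomotopic P \<delta> A \<kappa> \<phi>)"

definition dig_TC :: "nat \<Rightarrow> 'a set \<Rightarrow> ('a \<Rightarrow> 'a \<Rightarrow> bool) \<Rightarrow> enat" where
  "dig_TC m A \<kappa> = cover_number (A \<times> A) (\<lambda>X.
     \<exists>z\<ge>0. \<exists>s. dig_continuous X (NP \<kappa> \<kappa>) (path_space A \<kappa> z) (path_adj \<kappa> z) s \<and>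
       (\<forall>P \<delta> \<phi>. digital_complex m P \<delta> \<and> dig_continuous P \<delta> X (NP \<kappa> \<kappa>) \<phi> \<longrightarrow>
          dig_homotopic P \<delta> (A \<times> A) (NP \<kappa> \<kappa>) (path_ends z \<circ> s \<circ> \<phi>) \<phi>))"

end

theory Submission
  imports Defs
begin

text \<open>
  Digital homotopy is an equivalence relation compatible with composition, and constant maps at
  joined points are homotopic. Hence a nullhomotopy \<open>\<phi> \<simeq> c\<close> gives \<open>h \<circ> \<phi> \<simeq> h c \<simeq> k c \<simeq> k \<circ> \<phi>\<close>,
  which is the first inequality. For the second, a motion planner \<open>s\<close> on a piece \<open>X\<close> of \<open>A \<times> A\<close>
  contracts every map \<open>\<phi>\<close> into the slice \<open>{a. (a, a\<^sub>0) \<in> X}\<close>: run along the path \<open>s (\<phi> p, a\<^sub>0)\<close>.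
  For the third, on a piece that is categorical in \<open>A \<times> A\<close> a constant motion planner suffices,
  because \<open>A \<times> A\<close> is connected and a planner is only required to have correct ends up to homotopy.
\<close>

section \<open>Digitally continuous maps and products\<close>

lemma dig_continuous_compose:
  assumes "dig_continuous A \<kappa> B \<mu> f" "dig_continuous B \<mu> C \<nu> g"
  shows "dig_continuous A \<kappa> C \<nu> (g \<circ> f)"
  using assms unfolding dig_continuous_def Pi_iff comp_def by metis

lemma dig_continuous_const: "c \<in> B \<Longrightarrow> dig_continuous A \<kappa> B \<mu> (\<lambda>_. c)"
  by (simp add: dig_continuous_def)

lemma dig_continuous_Pair:
  assumes "dig_continuous A \<kappa> B \<mu> f" "dig_continuous A \<kappa> C \<nu> g"
  shows "dig_continuous A \<kappa> (B \<times> C) (NP \<mu> \<nu>) (\<lambda>x. (f x, g x))"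
  using assms unfolding dig_continuous_def NP_def Pi_iff by auto

lemma dig_continuous_fst: "dig_continuous (A \<times> B) (NP \<kappa> \<mu>) A \<kappa> fst"
  unfolding dig_continuous_def NP_def by auto

lemma dig_continuous_snd: "dig_continuous (A \<times> B) (NP \<kappa> \<mu>) B \<mu> snd"
  unfolding dig_continuous_def NP_def by auto

lemma dig_continuous_id: "dig_continuous A \<kappa> A \<kappa> (\<lambda>x. x)"
  by (simp add: dig_continuous_def)

section \<open>Digital homotopies\<close>

text \<open>A curried working form of a homotopy. The premise also admits identical points, where
  the conclusion is trivial; this absorbs the distinctness clause of \<open>NP\<close>. Equality or
  \<open>c1\<close>-adjacency of times becomes a bound on their distance, so reasoning about time is
  linear arithmetic.\<close>

definition dig_homotopy ::
  "'a set \<Rightarrow> ('a \<Rightarrow> 'a \<Rightarrow> bool) \<Rightarrow> 'b set \<Rightarrow> ('b \<Rightarrow> 'b \<Rightarrow> bool) \<Rightarrow> int \<Rightarrow> ('a \<Rightarrow> int \<Rightarrow> 'b) \<Rightarrow> bool"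
  where
  "dig_homotopy A \<kappa> B \<mu> z H \<longleftrightarrow> 0 \<le> z \<and> (\<forall>a\<in>A. \<forall>t\<in>{0..z}. H a t \<in> B) \<and>
     (\<forall>a\<in>A. \<forall>a'\<in>A. \<forall>t\<in>{0..z}. \<forall>t'\<in>{0..z}. (a = a' \<or> \<kappa> a a') \<and> \<bar>t - t'\<bar> \<le> 1 \<longrightarrow>
        H a t = H a' t' \<or> \<mu> (H a t) (H a' t'))"

lemma dig_homotopyI:
  assumes "0 \<le> z"
    and "\<And>a t. \<lbrakk>a \<in> A; 0 \<le> t; t \<le> z\<rbrakk> \<Longrightarrow> H a t \<in> B"
    and "\<And>a a' t t'. \<lbrakk>a \<in> A; a' \<in> A; 0 \<le> t; t \<le> z; 0 \<le> t'; t' \<le> z; a = a' \<or> \<kappa> a a'; \<bar>t - t'\<bar> \<le> 1\<rbrakk>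
      \<Longrightarrow> H a t = H a' t' \<or> \<mu> (H a t) (H a' t')"
  shows "dig_homotopy A \<kappa> B \<mu> z H"
  unfolding dig_homotopy_def using assms by simp

lemma dig_homotopyD:
  assumes "dig_homotopy A \<kappa> B \<mu> z H"
  shows "0 \<le> z"
    and "\<lbrakk>a \<in> A; 0 \<le> t; t \<le> z\<rbrakk> \<Longrightarrow> H a t \<in> B"
    and "\<lbrakk>a \<in> A; a' \<in> A; 0 \<le> t; t \<le> z; 0 \<le> t'; t' \<le> z; a = a' \<or> \<kappa> a a'; \<bar>t - t'\<bar> \<le> 1\<rbrakk>
      \<Longrightarrow> H a t = H a' t' \<or> \<mu> (H a t) (H a' t')"
  using assms unfolding dig_homotopy_def by simp_all

text \<open>The continuity of \<open>h\<close> and \<open>k\<close> that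
  \<open>dig_homotopic\<close> demands is read off from the slices of \<open>H\<close> at times 0
  and \<open>z\<close>.\<close>

lemma dig_homotopicI:
  assumes H: "dig_homotopy A \<kappa> B \<mu> z H"
    and h: "\<And>a. a \<in> A \<Longrightarrow> H a 0 = h a" and k: "\<And>a. a \<in> A \<Longrightarrow> H a z = k a"
  shows "dig_homotopic A \<kappa> B \<mu> h k"
proof -
  note H = dig_homotopyD[OF H]
  have "dig_continuous A \<kappa> B \<mu> h"
    using H(1) H(2)[of _ 0] H(3)[of _ _ 0 0] h by (auto simp: dig_continuous_def)
  moreover have "dig_continuous A \<kappa> B \<mu> k"
    using H(1) H(2)[of _ z] H(3)[of _ _ z z] k by (auto simp: dig_continuous_def)
  moreover have "dig_continuous (A \<times> {0..z}) (NP \<kappa> c1) B \<mu> (\<lambda>(a, t). H a t)"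
    unfolding dig_continuous_def
  proof (intro conjI ballI impI)
    show "(\<lambda>(a, t). H a t) \<in> A \<times> {0..z} \<rightarrow> B"
      using H(2) by auto
  next
    fix x y assume xy: "x \<in> A \<times> {0..z}" "y \<in> A \<times> {0..z}" "NP \<kappa> c1 x y"
    obtain a t a' t' where [simp]: "x = (a, t)" "y = (a', t')" by (cases x, cases y)
    have "a = a' \<or> \<kappa> a a'" "\<bar>t - t'\<bar> \<le> 1"
      using xy(3) by (auto simp: NP_def c1_def)
    then show "(case x of (a, t) \<Rightarrow> H a t) = (case y of (a, t) \<Rightarrow> H a t) \<or>
        \<mu> (case x of (a, t) \<Rightarrow> H a t) (case y of (a, t) \<Rightarrow> H a t)"
      using xy H(3)[of a a' t t'] by simp
  qed
  ultimately show ?thesis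
    unfolding dig_homotopic_def using H(1) h k
    by (intro conjI exI[of _ z] exI[of _ "\<lambda>(a, t). H a t"]) auto
qed

lemma dig_homotopicE:
  assumes "dig_homotopic A \<kappa> B \<mu> h k"
  obtains z H where "dig_homotopy A \<kappa> B \<mu> z H" "\<forall>a\<in>A. H a 0 = h a" "\<forall>a\<in>A. H a z = k a"
proof -
  obtain z K where z: "z \<ge> 0" and cont: "dig_continuous (A \<times> {0..z}) (NP \<kappa> c1) B \<mu> K"
    and ends: "\<forall>a\<in>A. K (a, 0) = h a \<and> K (a, z) = k a"
    using assms unfolding dig_homotopic_def by blast
  have "dig_homotopy A \<kappa> B \<mu> z (\<lambda>a t. K (a, t))"
  proof (rule dig_homotopyI)
    show "K (a, t) \<in> B" if "a \<in> A" "0 \<le> t" "t \<le> z" for a t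
      using that cont by (auto simp: dig_continuous_def)
    show "K (a, t) = K (a', t') \<or> \<mu> (K (a, t)) (K (a', t'))"
      if "a \<in> A" "a' \<in> A" "0 \<le> t" "t \<le> z" "0 \<le> t'" "t' \<le> z" "a = a' \<or> \<kappa> a a'" "\<bar>t - t'\<bar> \<le> 1"
      for a a' t t'
    proof (cases "(a, t) = (a', t')")
      case False
      moreover have "t = t' \<or> c1 t t'"
        using that(8) by (auto simp: c1_def)
      ultimately have "NP \<kappa> c1 (a, t) (a', t')"
        using that(7) by (simp add: NP_def)
      then show ?thesis
        using cont that unfolding dig_continuous_def by auto
    qed auto
  qed (rule z)
  then show thesis
    using that ends by simp
qed

text \<open>Settles the empty complex separately: there the constant supplied by a nullhomotopy need
  not lie in the target.\<close>

lemma dig_homotopic_empty: "dig_homotopic {} \<kappa> B \<mu> h k"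
  by (rule dig_homotopicI[of _ _ _ _ 0 "\<lambda>_. undefined"]) (simp_all add: dig_homotopy_def)

lemma dig_homotopic_sym:
  assumes "dig_homotopic A \<kappa> B \<mu> h k"
  shows "dig_homotopic A \<kappa> B \<mu> k h"
proof -
  obtain z H where H: "dig_homotopy A \<kappa> B \<mu> z H" "\<forall>a\<in>A. H a 0 = h a" "\<forall>a\<in>A. H a z = k a"
    using assms by (rule dig_homotopicE)
  have "dig_homotopy A \<kappa> B \<mu> z (\<lambda>a t. H a (z - t))"
    using dig_homotopyD[OF H(1)] by (intro dig_homotopyI) simp_all
  then show ?thesis
    by (rule dig_homotopicI) (use H in auto)
qed

lemma dig_homotopic_trans [trans]:
  assumes "dig_homotopic A \<kappa> B \<mu> f g" "dig_homotopic A \<kappa> B \<mu> g h"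
  shows "dig_homotopic A \<kappa> B \<mu> f h"
proof -
  obtain y F where F: "dig_homotopy A \<kappa> B \<mu> y F" "\<forall>a\<in>A. F a 0 = f a" "\<forall>a\<in>A. F a y = g a"
    using assms(1) by (rule dig_homotopicE)
  obtain z G where G: "dig_homotopy A \<kappa> B \<mu> z G" "\<forall>a\<in>A. G a 0 = g a" "\<forall>a\<in>A. G a z = h a"
    using assms(2) by (rule dig_homotopicE)
  note F' = dig_homotopyD[OF F(1)] and G' = dig_homotopyD[OF G(1)]
  define H where "H a t = (if t \<le> y then F a t else G a (t - y))" for a t
  \<comment> \<open>At \<open>t = y\<close> both branches give \<open>g a\<close>, so the second
    formula is valid on a closed half that shares the time \<open>y\<close> with the first.\<close>
  have upper: "H a t = G a (t - y)" if "a \<in> A" "y \<le> t" for a t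
    using that F(3) G(2) by (auto simp: H_def)
  have "dig_homotopy A \<kappa> B \<mu> (y + z) H"
  proof (rule dig_homotopyI)
    fix a a' t t'
    assume *: "a \<in> A" "a' \<in> A" "0 \<le> t" "t \<le> y + z" "0 \<le> t'" "t' \<le> y + z"
      "a = a' \<or> \<kappa> a a'" "\<bar>t - t'\<bar> \<le> 1"
    \<comment> \<open>Integer times on strictly opposite sides of \<open>y\<close> are at least 2
      apart, so no pair straddles the junction.\<close>
    then consider "t \<le> y" "t' \<le> y" | "y \<le> t" "y \<le> t'" by linarith
    then show "H a t = H a' t' \<or> \<mu> (H a t) (H a' t')"
    proof cases
      case 1
      then show ?thesis using F'(3)[of a a' t t'] * by (simp add: H_def)
    next
      case 2
      then show ?thesis using G'(3)[of a a' "t - y" "t' - y"] * by (simp add: upper)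
    qed
  qed (use F' G' in \<open>auto simp: H_def\<close>)
  then show ?thesis
    by (rule dig_homotopicI) (use F G' G upper F' in \<open>auto simp: H_def\<close>)
qed

lemma dig_homotopic_compose_left:
  assumes "dig_homotopic A \<kappa> B \<mu> h k" "dig_continuous B \<mu> C \<nu> g"
  shows "dig_homotopic A \<kappa> C \<nu> (g \<circ> h) (g \<circ> k)"
proof -
  from assms(1) obtain z K where "z \<ge> 0" "dig_continuous (A \<times> {0..z}) (NP \<kappa> c1) B \<mu> K"
    "\<forall>a\<in>A. K (a, 0) = h a \<and> K (a, z) = k a"
    "dig_continuous A \<kappa> B \<mu> h" "dig_continuous A \<kappa> B \<mu> k"
    unfolding dig_homotopic_def by blast
  then show ?thesis
    unfolding dig_homotopic_def using assms(2)
    by (intro conjI exI[of _ z] exI[of _ "g \<circ> K"]) (auto intro: dig_continuous_compose)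
qed

text \<open>A chain from \<open>c\<close> to \<open>d\<close> serves as the time direction of the
  homotopy, independently of the point of \<open>A\<close>.\<close>

lemma dig_homotopic_const:
  assumes "dig_joined B \<mu> c d" "adjacency_on B \<mu>"
  shows "dig_homotopic A \<kappa> B \<mu> (\<lambda>_. c) (\<lambda>_. d)"
proof -
  obtain l b where b: "b 0 = c" "b l = d" "\<forall>i\<le>l. b i \<in> B"
    "\<forall>i<l. b i = b (Suc i) \<or> \<mu> (b i) (b (Suc i))"
    using assms(1) unfolding dig_joined_def by blast
  \<comment> \<open>Symmetry of \<open>\<mu>\<close> on \<open>B\<close> is needed because a
    homotopy compares times in both orders, while the chain is directed.\<close>
  have step: "b i = b (Suc i) \<or> \<mu> (b i) (b (Suc i)) \<and> \<mu> (b (Suc i)) (b i)" if "i < l" for i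
    using that b(3,4) assms(2) unfolding adjacency_on_def by (meson Suc_leI less_imp_le_nat)
  have "dig_homotopy A \<kappa> B \<mu> (int l) (\<lambda>_ t. b (nat t))"
  proof (rule dig_homotopyI)
    fix t t' :: int
    assume t: "0 \<le> t" "t \<le> int l" "0 \<le> t'" "t' \<le> int l" "\<bar>t - t'\<bar> \<le> 1"
    then consider "nat t = nat t'" | "nat t' = Suc (nat t)" | "nat t = Suc (nat t')" by linarith
    then show "b (nat t) = b (nat t') \<or> \<mu> (b (nat t)) (b (nat t'))"
    proof cases
      case 2
      then show ?thesis using step[of "nat t"] t by auto
    next
      case 3
      then show ?thesis using step[of "nat t'"] t by auto
    qed simp
  qed (use b in auto)
  then show ?thesis
    by (rule dig_homotopicI) (use b in auto)
qed

text \<open>The coordinates are moved one after the other: homotopies of constants in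
  \<open>A\<close> are pushed into the product by \<open>u \<mapsto> (u, y)\<close> and then by
  \<open>u \<mapsto> (x', u)\<close>.\<close>

lemma dig_homotopic_const_prod:
  assumes "dig_connected A \<kappa>" "adjacency_on A \<kappa>" "c \<in> A \<times> A" "d \<in> A \<times> A"
  shows "dig_homotopic P \<delta> (A \<times> A) (NP \<kappa> \<kappa>) (\<lambda>_. c) (\<lambda>_. d)"
proof -
  obtain x y x' y' where [simp]: "c = (x, y)" "d = (x', y')" by (cases c, cases d)
  have const: "dig_homotopic P \<delta> A \<kappa> (\<lambda>_. u) (\<lambda>_. v)" if "u \<in> A" "v \<in> A" for u v
    using assms(1) that unfolding dig_connected_def
    by (intro dig_homotopic_const[OF _ assms(2)]) blast
  have 1: "dig_homotopic P \<delta> (A \<times> A) (NP \<kappa> \<kappa>)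
      ((\<lambda>u. (u, y)) \<circ> (\<lambda>_. x)) ((\<lambda>u. (u, y)) \<circ> (\<lambda>_. x'))"
    using assms(3,4)
    by (intro dig_homotopic_compose_left[OF const] dig_continuous_Pair dig_continuous_id
        dig_continuous_const) auto
  have 2: "dig_homotopic P \<delta> (A \<times> A) (NP \<kappa> \<kappa>)
      ((\<lambda>u. (x', u)) \<circ> (\<lambda>_. y)) ((\<lambda>u. (x', u)) \<circ> (\<lambda>_. y'))"
    using assms(3,4)
    by (intro dig_homotopic_compose_left[OF const] dig_continuous_Pair dig_continuous_id
        dig_continuous_const) auto
  show ?thesis
    using dig_homotopic_trans[OF 1[unfolded comp_def] 2[unfolded comp_def]] by simp
qed

text \<open>A continuous family of paths is itself a homotopy from its starting points to its end
  points: \<open>path_adj\<close> compares values at equal or neighbouring times, just as a homotopy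
  must at adjacent parameters.\<close>

lemma dig_homotopic_path_ends:
  assumes "dig_continuous P \<delta> (path_space A \<kappa> z) (path_adj \<kappa> z) \<gamma>" "z \<ge> 0"
  shows "dig_homotopic P \<delta> A \<kappa> (fst \<circ> (path_ends z \<circ> \<gamma>)) (snd \<circ> (path_ends z \<circ> \<gamma>))"
proof (rule dig_homotopicI, rule dig_homotopyI)
  have path: "dig_continuous {0..z} c1 A \<kappa> (\<gamma> p)" if "p \<in> P" for p
    using assms(1) that by (auto simp: dig_continuous_def path_space_def)
  fix p p' t t'
  assume *: "p \<in> P" "p' \<in> P" "0 \<le> t" "t \<le> z" "0 \<le> t'" "t' \<le> z" "p = p' \<or> \<delta> p p'" "\<bar>t - t'\<bar> \<le> 1"
  then have tt': "t = t' \<or> c1 t t'" by (auto simp: c1_def)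
  have "\<gamma> p = \<gamma> p' \<or> path_adj \<kappa> z (\<gamma> p) (\<gamma> p')"
    using assms(1) * by (auto simp: dig_continuous_def)
  then show "\<gamma> p t = \<gamma> p' t' \<or> \<kappa> (\<gamma> p t) (\<gamma> p' t')"
  proof
    \<comment> \<open>When the two paths coincide, the comparison across neighbouring times comes
      from the continuity of that single path.\<close>
    assume "\<gamma> p = \<gamma> p'"
    then show ?thesis using path[of p'] * tt' unfolding dig_continuous_def by (metis atLeastAtMost_iff)
  next
    assume "path_adj \<kappa> z (\<gamma> p) (\<gamma> p')"
    then show ?thesis using * tt' unfolding path_adj_def by (metis atLeastAtMost_iff)
  qed
next
  show "\<gamma> p t \<in> A" if "p \<in> P" "0 \<le> t" "t \<le> z" for p t
    using that assms(1) by (auto simp: dig_continuous_def path_space_def Pi_iff)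
qed (simp_all add: path_ends_def assms(2))

section \<open>Comparing cover numbers\<close>

text \<open>Preimages under \<open>f\<close> turn a cover of \<open>A\<close> into a cover of
  \<open>B\<close> with the same index set, so every \<open>q\<close> admissible for
  \<open>A\<close> is admissible for \<open>B\<close>. Comparing infima of these sets also handles
  the infinite values.\<close>

lemma cover_number_le_vimage:
  assumes "f \<in> B \<rightarrow> A" and "\<And>X. X \<subseteq> A \<Longrightarrow> Q X \<Longrightarrow> R (B \<inter> f -` X)"
  shows "cover_number B R \<le> cover_number A Q"
  unfolding cover_number_def
proof (rule Inf_superset_mono, clarify)
  fix q and X :: "nat \<Rightarrow> _" assume X: "A = (\<Union>j\<le>q. X j)" "\<forall>j\<le>q. Q (X j)"
  show "\<exists>q'. enat q = enat q' \<and> (\<exists>Y. B = (\<Union>j\<le>q'. Y j) \<and> (\<forall>j\<le>q'. R (Y j)))"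
  proof (intro exI conjI allI impI)
    show "B = (\<Union>j\<le>q. B \<inter> f -` X j)"
      using assms(1) unfolding X(1) by blast
    show "R (B \<inter> f -` X j)" if "j \<le> q" for j
      using that X by (intro assms(2)) auto
  qed simp
qed

lemma cover_number_le:
  assumes "\<And>X. X \<subseteq> A \<Longrightarrow> Q X \<Longrightarrow> R X"
  shows "cover_number A R \<le> cover_number A Q"
  by (rule cover_number_le_vimage[of "\<lambda>x. x"]) (use assms in \<open>auto simp: Int_absorb1\<close>)

text \<open>On a nonempty domain, continuity of the constant end map forces its value into
  \<open>B\<close>.\<close>

lemma dig_nullhomotopicE:
  assumes "dig_nullhomotopic A \<kappa> B \<mu> h" "A \<noteq> {}"
  obtains c where "c \<in> B" "dig_homotopic A \<kappa> B \<mu> h (\<lambda>_. c)"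
proof -
  obtain c where c: "dig_homotopic A \<kappa> B \<mu> h (\<lambda>_. c)"
    using assms(1) unfolding dig_nullhomotopic_def by blast
  moreover have "c \<in> B"
    using c assms(2) unfolding dig_homotopic_def dig_continuous_def by auto
  ultimately show thesis using that by blast
qed

section \<open>The three inequalities\<close>

lemma dig_dist_le_dig_cat:
  assumes h: "dig_continuous A \<kappa> B \<mu> h" and k: "dig_continuous A \<kappa> B \<mu> k"
    and adj: "adjacency_on B \<mu>" and joined: "\<forall>a\<in>A. dig_joined B \<mu> (h a) (k a)"
  shows "dig_dist m A \<kappa> B \<mu> h k \<le> dig_cat m A \<kappa>"
  unfolding dig_dist_def dig_cat_def
proof (rule cover_number_le, intro allI impI)
  fix X :: "'a set" and P \<delta> \<phi>
  assume Q: "\<forall>P \<delta> \<phi>. digital_complex m P \<delta> \<and> dig_continuous P \<delta> X \<kappa> \<phi> \<longrightarrow>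
      dig_nullhomotopic P \<delta> A \<kappa> \<phi>"
    and \<phi>: "digital_complex m P \<delta> \<and> dig_continuous P \<delta> X \<kappa> \<phi>"
  show "dig_homotopic P \<delta> B \<mu> (h \<circ> \<phi>) (k \<circ> \<phi>)"
  proof (cases "P = {}")
    case False
    then obtain c where c: "c \<in> A" "dig_homotopic P \<delta> A \<kappa> \<phi> (\<lambda>_. c)"
      using Q \<phi> dig_nullhomotopicE by blast
    have "dig_homotopic P \<delta> B \<mu> (h \<circ> \<phi>) (\<lambda>_. h c)"
      using dig_homotopic_compose_left[OF c(2) h] by (simp add: comp_def)
    \<comment> \<open>The nullhomotopy runs in \<open>A\<close>, so \<open>c\<close> may lie outside
      \<open>X\<close>; hence \<open>h\<close> and \<open>k\<close> must be joined at every point of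
      \<open>A\<close>.\<close>
    also have "dig_homotopic P \<delta> B \<mu> (\<lambda>_. h c) (\<lambda>_. k c)"
      using joined c(1) by (intro dig_homotopic_const[OF _ adj]) blast
    also have "dig_homotopic P \<delta> B \<mu> (\<lambda>_. k c) (k \<circ> \<phi>)"
      using dig_homotopic_compose_left[OF dig_homotopic_sym[OF c(2)] k] by (simp add: comp_def)
    finally show ?thesis .
  qed (simp add: dig_homotopic_empty)
qed

lemma dig_cat_le_dig_TC: "dig_cat m A \<kappa> \<le> dig_TC m A \<kappa>"
  unfolding dig_cat_def dig_TC_def
proof (rule cover_number_le_vimage)
  \<comment> \<open>If \<open>A\<close> is empty, the base point is arbitrary and never used.\<close>
  define a0 where "a0 = (SOME a. a \<in> A)"
  have a0: "a0 \<in> A" if "a \<in> A" for a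
    unfolding a0_def using that by (rule someI)
  show "(\<lambda>a. (a, a0)) \<in> A \<rightarrow> A \<times> A" using a0 by auto
  fix X
  assume "\<exists>z\<ge>0. \<exists>s. dig_continuous X (NP \<kappa> \<kappa>) (path_space A \<kappa> z) (path_adj \<kappa> z) s \<and>
    (\<forall>P \<delta> \<phi>. digital_complex m P \<delta> \<and> dig_continuous P \<delta> X (NP \<kappa> \<kappa>) \<phi> \<longrightarrow>
      dig_homotopic P \<delta> (A \<times> A) (NP \<kappa> \<kappa>) (path_ends z \<circ> s \<circ> \<phi>) \<phi>)"
  then obtain z s where z: "z \<ge> 0"
    and s: "dig_continuous X (NP \<kappa> \<kappa>) (path_space A \<kappa> z) (path_adj \<kappa> z) s"
    and ends: "\<And>P \<delta> \<phi>. \<lbrakk>digital_complex m P \<delta>; dig_continuous P \<delta> X (NP \<kappa> \<kappa>) \<phi>\<rbrakk> \<Longrightarrow>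
      dig_homotopic P \<delta> (A \<times> A) (NP \<kappa> \<kappa>) (path_ends z \<circ> s \<circ> \<phi>) \<phi>"
    by blast
  show "\<forall>P \<delta> \<phi>. digital_complex m P \<delta> \<and> dig_continuous P \<delta> (A \<inter> (\<lambda>a. (a, a0)) -` X) \<kappa> \<phi> \<longrightarrow>
    dig_nullhomotopic P \<delta> A \<kappa> \<phi>"
  proof (intro allI impI, elim conjE)
    fix P \<delta> \<phi>
    assume P: "digital_complex m P \<delta>"
      and \<phi>: "dig_continuous P \<delta> (A \<inter> (\<lambda>a. (a, a0)) -` X) \<kappa> \<phi>"
    define \<psi> where "\<psi> p = (\<phi> p, a0)" for p
    have \<psi>: "dig_continuous P \<delta> X (NP \<kappa> \<kappa>) \<psi>"
      using \<phi> unfolding dig_continuous_def NP_def \<psi>_def Pi_iff by auto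
    have e: "dig_homotopic P \<delta> (A \<times> A) (NP \<kappa> \<kappa>) (path_ends z \<circ> (s \<circ> \<psi>)) \<psi>"
      using ends[OF P \<psi>] by (simp add: comp_assoc)
    \<comment> \<open>The planner has correct ends only up to homotopy, so \<open>e\<close> is used
      twice, once through each projection, with the run along the planned paths in between. The
      chain leads from \<open>\<phi>\<close> to the constant \<open>a0\<close>.\<close>
    have "dig_homotopic P \<delta> A \<kappa> (fst \<circ> \<psi>) (fst \<circ> (path_ends z \<circ> (s \<circ> \<psi>)))"
      using dig_homotopic_compose_left[OF dig_homotopic_sym[OF e] dig_continuous_fst] .
    also have "dig_homotopic P \<delta> A \<kappa>
        (fst \<circ> (path_ends z \<circ> (s \<circ> \<psi>))) (snd \<circ> (path_ends z \<circ> (s \<circ> \<psi>)))"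
      using dig_homotopic_path_ends[OF dig_continuous_compose[OF \<psi> s] z] .
    also have "dig_homotopic P \<delta> A \<kappa> (snd \<circ> (path_ends z \<circ> (s \<circ> \<psi>))) (snd \<circ> \<psi>)"
      using dig_homotopic_compose_left[OF e dig_continuous_snd] .
    finally have "dig_homotopic P \<delta> A \<kappa> (fst \<circ> \<psi>) (snd \<circ> \<psi>)" .
    then show "dig_nullhomotopic P \<delta> A \<kappa> \<phi>"
      unfolding dig_nullhomotopic_def by (auto simp: \<psi>_def comp_def)
  qed
qed

lemma dig_TC_le_dig_cat_prod:
  assumes conn: "dig_connected A \<kappa>" and adj: "adjacency_on A \<kappa>"
  shows "dig_TC m A \<kappa> \<le> dig_cat m (A \<times> A) (NP \<kappa> \<kappa>)"
  unfolding dig_TC_def dig_cat_def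
proof (rule cover_number_le)
  fix X
  assume X: "X \<subseteq> A \<times> A"
    and Q: "\<forall>P \<delta> \<phi>. digital_complex m P \<delta> \<and> dig_continuous P \<delta> X (NP \<kappa> \<kappa>) \<phi> \<longrightarrow>
      dig_nullhomotopic P \<delta> (A \<times> A) (NP \<kappa> \<kappa>) \<phi>"
  \<comment> \<open>If \<open>A\<close> is empty, so is \<open>X\<close>, and the arbitrary value of
    \<open>a0\<close> does no harm.\<close>
  define a0 where "a0 = (SOME a. a \<in> A)"
  have a0: "a0 \<in> A" if "a \<in> A" for a
    unfolding a0_def using that by (rule someI)
  \<comment> \<open>Paths of length 0 suffice: every input gets the one-point path at
    \<open>a0\<close>, with ends \<open>(a0, a0)\<close>. The restriction makes it extensional, as
    \<open>path_space\<close> demands.\<close>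
  define s where "s x = restrict (\<lambda>_. a0) {0..0::int}" for x :: "'a \<times> 'a"
  have "dig_continuous X (NP \<kappa> \<kappa>) (path_space A \<kappa> 0) (path_adj \<kappa> 0) s"
    using X a0 by (auto simp: dig_continuous_def path_space_def s_def)
  moreover have "dig_homotopic P \<delta> (A \<times> A) (NP \<kappa> \<kappa>) (path_ends 0 \<circ> s \<circ> \<phi>) \<phi>"
    if P: "digital_complex m P \<delta>" and \<phi>: "dig_continuous P \<delta> X (NP \<kappa> \<kappa>) \<phi>" for P \<delta> \<phi>
  proof (cases "P = {}")
    case False
    then obtain c where c: "c \<in> A \<times> A" "dig_homotopic P \<delta> (A \<times> A) (NP \<kappa> \<kappa>) \<phi> (\<lambda>_. c)"
      using Q P \<phi> dig_nullhomotopicE by blast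
    have "dig_homotopic P \<delta> (A \<times> A) (NP \<kappa> \<kappa>) (\<lambda>_. (a0, a0)) (\<lambda>_. c)"
      using c(1) a0 by (intro dig_homotopic_const_prod[OF conn adj]) auto
    also have "dig_homotopic P \<delta> (A \<times> A) (NP \<kappa> \<kappa>) (\<lambda>_. c) \<phi>"
      using dig_homotopic_sym[OF c(2)] .
    finally show ?thesis by (simp add: comp_def path_ends_def s_def)
  qed (simp add: dig_homotopic_empty)
  ultimately show "\<exists>z\<ge>0. \<exists>s. dig_continuous X (NP \<kappa> \<kappa>) (path_space A \<kappa> z) (path_adj \<kappa> z) s \<and>
    (\<forall>P \<delta> \<phi>. digital_complex m P \<delta> \<and> dig_continuous P \<delta> X (NP \<kappa> \<kappa>) \<phi> \<longrightarrow>
      dig_homotopic P \<delta> (A \<times> A) (NP \<kappa> \<kappa>) (path_ends z \<circ> s \<circ> \<phi>) \<phi>)"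
    by blast
qed

text \<open>The pointwise joining of \<open>h\<close> and \<open>k\<close> serves the first
  inequality. It is automatic when \<open>A'\<close> is connected; constants in different components
  of \<open>A'\<close> show that the inequality can fail otherwise.\<close>

theorem corollary3p12:
  fixes m r r' :: nat
    and A A' :: "int list set"
    and \<kappa> \<mu> :: "int list \<Rightarrow> int list \<Rightarrow> bool"
    and h k :: "int list \<Rightarrow> int list"
  assumes "m \<ge> 1"
    and "digital_image r A \<kappa>"
    and "dig_connected A \<kappa>"
    and "digital_image r' A' \<mu>"
    and "dig_continuous A \<kappa> A' \<mu> h"
    and "dig_continuous A \<kappa> A' \<mu> k"
    and "\<forall>a\<in>A. dig_joined A' \<mu> (h a) (k a)"
  shows "dig_dist m A \<kappa> A' \<mu> h k \<le> dig_cat m A \<kappa>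
    \<and> dig_cat m A \<kappa> \<le> dig_TC m A \<kappa>
    \<and> dig_TC m A \<kappa> \<le> dig_cat m (A \<times> A) (NP \<kappa> \<kappa>)"
  using assms unfolding digital_image_def
  by (intro conjI dig_dist_le_dig_cat dig_cat_le_dig_TC dig_TC_le_dig_cat_prod) auto

end
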